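(* Assume $MA_{\omega_1}$. If $G$ is a rectangular graph of cardinality $\omega_1$, then $G$ contains an uncountable clique or an uncountable anticlique (independent set).
   Context: Graphs are sets with a symmetric irreflexive edge relation $E$. Tuples $(x_1,\dots,x_n),(y_1,\dots,y_n)$ of vertices with disjoint entry sets are alike if: for all $i,j$, ($x_iEy_i\iff x_jEy_j$); for all $i,j$, ($x_iEx_j\iff y_iEy_j$); and for all $i,j$ with $x_i\neq x_j$, ($x_iEx_j\iff x_iEy_j\iff y_iEx_j$). A graph is rectangular if it is uncountable and for every $n$ and every family of $\omega_1$ many $n$-tuples of vertices with pairwise disjoint entry sets, two distinct members are alike. *)

theory Defs
  imports "HOL-Library.Countable_Set" "HOL-Library.Disjoint_Sets"
begin

unbundle cardinal_syntax

abbreviation omega1 :: "nat set rel" (\<open>\<omega>\<^sub>1\<close>)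
  where "\<omega>\<^sub>1 \<equiv> cardSuc natLeq"


subsection \<open>Martin's Axiom\<close>

definition poset :: "'p set \<Rightarrow> ('p \<Rightarrow> 'p \<Rightarrow> bool) \<Rightarrow> bool"
  where "poset P le \<longleftrightarrow> P \<noteq> {} \<and> reflp_on P le \<and> transp_on P le \<and> antisymp_on P le"

definition compatible :: "'p set \<Rightarrow> ('p \<Rightarrow> 'p \<Rightarrow> bool) \<Rightarrow> 'p \<Rightarrow> 'p \<Rightarrow> bool"
  where "compatible P le p q \<longleftrightarrow> (\<exists>r\<in>P. le r p \<and> le r q)"

definition ccc :: "'p set \<Rightarrow> ('p \<Rightarrow> 'p \<Rightarrow> bool) \<Rightarrow> bool"
  where "ccc P le \<longleftrightarrow>
    (\<forall>A. A \<subseteq> P \<and> pairwise (\<lambda>p q. \<not> compatible P le p q) A \<longrightarrow> countable A)"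

definition dense_subset :: "'p set \<Rightarrow> ('p \<Rightarrow> 'p \<Rightarrow> bool) \<Rightarrow> 'p set \<Rightarrow> bool"
  where "dense_subset P le D \<longleftrightarrow> D \<subseteq> P \<and> (\<forall>p\<in>P. \<exists>d\<in>D. le d p)"

definition poset_filter :: "'p set \<Rightarrow> ('p \<Rightarrow> 'p \<Rightarrow> bool) \<Rightarrow> 'p set \<Rightarrow> bool"
  where "poset_filter P le F \<longleftrightarrow> F \<subseteq> P \<and> F \<noteq> {} \<and>
    (\<forall>p\<in>F. \<forall>q\<in>P. le p q \<longrightarrow> q \<in> F) \<and>
    (\<forall>p\<in>F. \<forall>q\<in>F. \<exists>r\<in>F. le r p \<and> le r q)"

text \<open>Martin's Axiom speaks about all posets, but a HOL formula cannot quantify over types. Hence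
  the axiom is parameterised by the type \<open>'p\<close> of which the carriers of the posets are subsets.
  When \<open>'p\<close> is countable it is provable outright, so it is meant to be used with
  an uncountable \<open>'p\<close>.\<close>

definition MA_omega1 :: "'p itself \<Rightarrow> bool"
  where "MA_omega1 (_ :: 'p itself) \<longleftrightarrow>
    (\<forall>(P :: 'p set) le. poset P le \<and> ccc P le \<longrightarrow>
      (\<forall>\<D>. |\<D>| \<le>o \<omega>\<^sub>1 \<and> (\<forall>D\<in>\<D>. dense_subset P le D) \<longrightarrow>
        (\<exists>F. poset_filter P le F \<and> (\<forall>D\<in>\<D>. F \<inter> D \<noteq> {}))))"


subsection \<open>Graphs\<close>

definition simple_graph :: "'a set \<Rightarrow> ('a \<Rightarrow> 'a \<Rightarrow> bool) \<Rightarrow> bool"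
  where "simple_graph V E \<longleftrightarrow> symp_on V E \<and> irreflp_on V E"

definition clique :: "('a \<Rightarrow> 'a \<Rightarrow> bool) \<Rightarrow> 'a set \<Rightarrow> bool"
  where "clique E C \<longleftrightarrow> (\<forall>x\<in>C. \<forall>y\<in>C. x \<noteq> y \<longrightarrow> E x y)"

definition anticlique :: "('a \<Rightarrow> 'a \<Rightarrow> bool) \<Rightarrow> 'a set \<Rightarrow> bool"
  where "anticlique E C \<longleftrightarrow> (\<forall>x\<in>C. \<forall>y\<in>C. \<not> E x y)"

text \<open>An \<open>n\<close>-tuple of vertices is a list of length \<open>n\<close>; repeated entries are allowed.\<close>

definition alike :: "('a \<Rightarrow> 'a \<Rightarrow> bool) \<Rightarrow> 'a list \<Rightarrow> 'a list \<Rightarrow> bool"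
  where "alike E x y \<longleftrightarrow> length x = length y \<and> set x \<inter> set y = {} \<and>
    (\<forall>i<length x. \<forall>j<length x. E (x ! i) (y ! i) \<longleftrightarrow> E (x ! j) (y ! j)) \<and>
    (\<forall>i<length x. \<forall>j<length x. E (x ! i) (x ! j) \<longleftrightarrow> E (y ! i) (y ! j)) \<and>
    (\<forall>i<length x. \<forall>j<length x. x ! i \<noteq> x ! j \<longrightarrow>
      (E (x ! i) (x ! j) \<longleftrightarrow> E (x ! i) (y ! j)) \<and>
      (E (x ! i) (y ! j) \<longleftrightarrow> E (y ! i) (x ! j)))"

definition rectangular :: "'a set \<Rightarrow> ('a \<Rightarrow> 'a \<Rightarrow> bool) \<Rightarrow> bool"
  where "rectangular V E \<longleftrightarrow> uncountable V \<and>
    (\<forall>n T. |T| =o \<omega>\<^sub>1 \<and> (\<forall>x\<in>T. length x = n \<and> set x \<subseteq> V) \<and> disjoint_family_on set T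
      \<longrightarrow> (\<exists>x\<in>T. \<exists>y\<in>T. x \<noteq> y \<and> alike E x y))"

end

theory Submission
  imports Defs "HOL-Library.Countable_Set_Type"
begin

text \<open>Order the finite cliques, and likewise the finite anticliques, by reverse inclusion.
  If one of these two posets is ccc, Martin's Axiom yields an uncountable homogeneous set.
  If neither is, the \<open>\<Delta>\<close>-system lemma turns uncountable antichains into uncountable families
  of pairwise disjoint finite sets: anticliques \<open>s\<close>, any two of which are joined by an edge, and
  cliques \<open>t\<close>, any two of which are joined by a non-edge. Concatenate them in pairs to tuples
  and let \<open>x\<close>, \<open>y\<close> be alike. An edge \<open>x\<^sub>i E y\<^sub>j\<close> between the anticlique
  parts has \<open>i = j\<close>, for otherwise \<open>x\<^sub>i E x\<^sub>j\<close>; similarly a non-edge between the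
  clique parts is of the form \<open>\<not> x\<^sub>k E y\<^sub>k\<close>. But alike tuples satisfy
  \<open>x\<^sub>i E y\<^sub>i \<longleftrightarrow> x\<^sub>k E y\<^sub>k\<close>.\<close>

subsection \<open>Uncountable families of finite sets\<close>

text \<open>\<open>\<omega>\<^sub>1\<close> is the cardinal successor of \<open>natLeq\<close>, so
  lying strictly above \<open>natLeq\<close> is the same as lying at or above
  \<open>\<omega>\<^sub>1\<close>. This links countability with the cardinal comparisons in Martin's
  Axiom and rectangularity.\<close>

lemma uncountable_iff_omega1: "uncountable A \<longleftrightarrow> \<omega>\<^sub>1 \<le>o |A|"
  unfolding countable_card_le_natLeq
  by (simp add: not_ordLeq_iff_ordLess card_of_Well_order natLeq_Well_order
      cardSuc_ordLess_ordLeq natLeq_Card_order card_of_Card_order)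

text \<open>Sets of size \<open>Suc n\<close> arise by inserting a point into sets of size
  \<open>n\<close>. An infinite \<open>A\<close> absorbs the product with \<open>A\<close> at each
  such step, and finally the countable union over all sizes.\<close>

lemma infinite_Fpow_ordLeq:
  assumes "infinite A"
  shows "|{S. finite S \<and> S \<subseteq> A}| \<le>o |A|"
proof -
  let ?F = "\<lambda>n. {S. finite S \<and> S \<subseteq> A \<and> card S = n}"
  have "|?F n| \<le>o |A|" for n
  proof (induction n)
    case 0
    have "?F 0 \<subseteq> {{}}" by auto
    then have "finite (?F 0)" using finite_subset by blast
    then show ?case
      using assms by (metis card_of_Well_order card_of_ordLeq_infinite ordLeq_total)
  next
    case (Suc n)
    have "?F (Suc n) \<subseteq> (\<lambda>(a, S). insert a S) ` (A \<times> ?F n)"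
    proof
      fix S assume "S \<in> ?F (Suc n)"
      moreover from this obtain a S' where "S = insert a S'" "a \<notin> S'" "card S' = n"
        by (auto simp: card_Suc_eq)
      ultimately show "S \<in> (\<lambda>(a, S). insert a S) ` (A \<times> ?F n)" by force
    qed
    then have "|?F (Suc n)| \<le>o |A \<times> ?F n|"
      using surj_imp_ordLeq by blast
    also have "|A \<times> ?F n| \<le>o |A|"
      using Suc assms by (intro card_of_Sigma_ordLeq_infinite) (auto intro: card_of_mono1)
    finally show ?case .
  qed
  then have "|\<Union>n. ?F n| \<le>o |A|"
    using assms infinite_iff_card_of_nat by (intro card_of_UNION_ordLeq_infinite) auto
  moreover have "(\<Union>n. ?F n) = {S. finite S \<and> S \<subseteq> A}" by auto
  ultimately show ?thesis by simp
qed

text \<open>Zorn's lemma, with maximality unfolded to the form used later: an outside point related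
  to no member could be added. It serves both for disjoint families and for antichains.\<close>

lemma ex_maximal_pairwise:
  assumes "symp R"
  obtains M where "M \<subseteq> X" "pairwise (\<lambda>x y. \<not> R x y) M"
    "\<And>x. x \<in> X \<Longrightarrow> x \<notin> M \<Longrightarrow> \<exists>y\<in>M. R x y"
proof -
  let ?A = "{M. M \<subseteq> X \<and> pairwise (\<lambda>x y. \<not> R x y) M}"
  have "\<Union>C \<in> ?A" if C: "subset.chain ?A C" for C
  proof -
    have "\<not> R x y" if xy: "x \<in> a" "a \<in> C" "y \<in> b" "b \<in> C" "x \<noteq> y" for x y a b
    proof -
      have "a \<subseteq> b \<or> b \<subseteq> a" using C xy by (simp add: subset_chain_def)
      then obtain c where "c \<in> C" "x \<in> c" "y \<in> c" using xy by blast
      moreover from this have "pairwise (\<lambda>x y. \<not> R x y) c" using C by (auto simp: subset_chain_def)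
      ultimately show ?thesis using xy(5) by (simp add: pairwise_def)
    qed
    then have "pairwise (\<lambda>x y. \<not> R x y) (\<Union>C)" unfolding pairwise_def by blast
    moreover have "\<Union>C \<subseteq> X" using C by (auto simp: subset_chain_def)
    ultimately show ?thesis by blast
  qed
  then have "\<exists>M\<in>?A. \<forall>Y\<in>?A. M \<subseteq> Y \<longrightarrow> Y = M" by (rule subset_Zorn')
  then obtain M where M: "M \<in> ?A" and max: "\<forall>Y\<in>?A. M \<subseteq> Y \<longrightarrow> Y = M" ..
  show thesis
  proof
    show "M \<subseteq> X" "pairwise (\<lambda>x y. \<not> R x y) M" using M by auto
    fix x assume x: "x \<in> X" "x \<notin> M"
    show "\<exists>y\<in>M. R x y"
    proof (rule ccontr)
      assume "\<not> ?thesis"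
      then have "\<forall>y\<in>M. \<not> R x y \<and> \<not> R y x" using assms by (meson sympD)
      then have "insert x M \<in> ?A" using M x(1) by (simp add: pairwise_insert)
      then show False using max x by blast
    qed
  qed
qed

text \<open>Take a maximal disjoint subfamily \<open>M\<close>. If \<open>M\<close> were countable,
  its sets would cover only countably many points; every index outside \<open>M\<close> has a set
  meeting one of these points, and each point serves only countably many indices, so
  \<open>I\<close> would be countable.\<close>

lemma uncountable_disjoint_subfamily:
  assumes "uncountable I" and cnt: "\<And>i. i \<in> I \<Longrightarrow> countable (f i)"
    and pt: "\<And>x. countable {i\<in>I. x \<in> f i}"
  obtains J where "J \<subseteq> I" "uncountable J" "disjoint_family_on f J"
proof -
  have sym: "symp (\<lambda>i j. f i \<inter> f j \<noteq> {})" by (auto simp: symp_def)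
  obtain M where M: "M \<subseteq> I" "pairwise (\<lambda>i j. \<not> f i \<inter> f j \<noteq> {}) M"
    and max: "\<And>i. i \<in> I \<Longrightarrow> i \<notin> M \<Longrightarrow> \<exists>j\<in>M. f i \<inter> f j \<noteq> {}"
    by (rule ex_maximal_pairwise[OF sym, of I]) (rule that)
  have "uncountable M"
  proof
    assume "countable M"
    then have "countable (M \<union> (\<Union>x\<in>(\<Union>j\<in>M. f j). {i\<in>I. x \<in> f i}))"
      using M(1) cnt pt by (intro countable_Un countable_UN) auto
    moreover have "I \<subseteq> M \<union> (\<Union>x\<in>(\<Union>j\<in>M. f j). {i\<in>I. x \<in> f i})"
      using max by fastforce
    ultimately show False using assms(1) countable_subset by blast
  qed
  with M show thesis
    using that by (auto simp: disjoint_family_on_def pairwise_def)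
qed

text \<open>The \<Delta>-system lemma for sets of one finite size. A point in uncountably many
  members is removed, the induction hypothesis is applied, and the point joins the root
  \<open>R\<close>. If there is no such point, a disjoint subfamily exists and the root is
  empty.\<close>

lemma delta_system:
  assumes "uncountable A" "\<And>a. a \<in> A \<Longrightarrow> finite a \<and> card a = n"
  shows "\<exists>R B. B \<subseteq> A \<and> uncountable B \<and> (\<forall>a\<in>B. \<forall>b\<in>B. a \<noteq> b \<longrightarrow> a \<inter> b = R)"
  using assms
proof (induction n arbitrary: A)
  case 0
  then have "A \<subseteq> {{}}" using card_0_eq by blast
  then show ?case using 0 countable_subset by blast
next
  case (Suc n)
  show ?case
  proof (cases "\<exists>x. uncountable {a\<in>A. x \<in> a}")
    case True
    then obtain x where x: "uncountable {a\<in>A. x \<in> a}" by blast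
    let ?A = "(\<lambda>a. a - {x}) ` {a\<in>A. x \<in> a}"
    have "inj_on (\<lambda>a. a - {x}) {a\<in>A. x \<in> a}" by (auto simp: inj_on_def)
    then have "uncountable ?A" using x countable_image_inj_on by blast
    moreover have "finite a \<and> card a = n" if "a \<in> ?A" for a
      using that Suc.prems(2) by force
    ultimately obtain R B where B: "B \<subseteq> ?A" "uncountable B"
      and R: "\<forall>a\<in>B. \<forall>b\<in>B. a \<noteq> b \<longrightarrow> a \<inter> b = R"
      using Suc.IH by meson
    \<comment> \<open>The members of \<open>B\<close> omit \<open>x\<close>, so putting it back
      loses nothing.\<close>
    have "inj_on (insert x) B" using B(1) by (auto simp: inj_on_def)
    then have "uncountable (insert x ` B)" using B(2) countable_image_inj_on by blast
    moreover have "insert x ` B \<subseteq> A" using B(1) by (auto simp: insert_absorb)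
    moreover have "\<forall>a\<in>insert x ` B. \<forall>b\<in>insert x ` B. a \<noteq> b \<longrightarrow> a \<inter> b = insert x R"
      using R by fastforce
    ultimately show ?thesis by blast
  next
    case False
    have "countable a" if "a \<in> A" for a
      using that Suc.prems(2) by (simp add: countable_finite)
    moreover have "countable {a\<in>A. x \<in> a}" for x using False by blast
    ultimately obtain B where "B \<subseteq> A" "uncountable B" "disjoint_family_on (\<lambda>a. a) B"
      using uncountable_disjoint_subfamily[OF Suc.prems(1), of "\<lambda>a. a"] by metis
    then show ?thesis by (auto simp: disjoint_family_on_def)
  qed
qed

subsection \<open>Martin's Axiom\<close>

text \<open>The axiom at type \<open>'p\<close> covers only posets carried by subsets of
  \<open>'p\<close>. A poset of size at most \<open>\<omega>\<^sub>1\<close> embeds into the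
  uncountable type \<open>'p\<close>; the axiom is applied to the copy and the filter is pulled
  back.\<close>

lemma MA_omega1_filter:
  fixes P :: "'q set"
  assumes "uncountable (UNIV :: 'p set)" "MA_omega1 TYPE('p)" "|P| \<le>o \<omega>\<^sub>1"
    and po: "poset P le" and ccc: "ccc P le"
    and D: "|\<D>| \<le>o \<omega>\<^sub>1" "\<And>D. D \<in> \<D> \<Longrightarrow> dense_subset P le D"
  obtains F where "poset_filter P le F" "\<And>D. D \<in> \<D> \<Longrightarrow> F \<inter> D \<noteq> {}"
proof -
  have "|P| \<le>o |UNIV :: 'p set|"
    using assms(1,3) ordLeq_transitive uncountable_iff_omega1 by blast
  then obtain f :: "'q \<Rightarrow> 'p" where f: "inj_on f P"
    by (meson card_of_ordLeq)
  define le' where "le' x y = le (inv_into P f x) (inv_into P f y)" for x y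
  have le': "le' (f x) (f y) \<longleftrightarrow> le x y" if "x \<in> P" "y \<in> P" for x y
    using that f by (simp add: le'_def)
  have compat: "compatible (f ` P) le' (f x) (f y) \<longleftrightarrow> compatible P le x y"
    if "x \<in> P" "y \<in> P" for x y
    using that le' by (auto simp: compatible_def)
  have "poset (f ` P) le'"
    unfolding poset_def
  proof (intro conjI reflp_onI transp_onI antisymp_onI)
    show "f ` P \<noteq> {}" using po by (simp add: poset_def)
    show "le' x x" if "x \<in> f ` P" for x
      using that po le' by (auto simp: poset_def reflp_on_def)
    show "le' x z" if "x \<in> f ` P" "y \<in> f ` P" "z \<in> f ` P" "le' x y" "le' y z" for x y z
      using that po unfolding poset_def by (elim imageE) (metis le' transp_onD)
    show "x = y" if "x \<in> f ` P" "y \<in> f ` P" "le' x y" "le' y x" for x y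
      using that po unfolding poset_def by (elim imageE) (metis le' antisymp_onD)
  qed
  moreover have "ccc (f ` P) le'"
    unfolding ccc_def
  proof (intro allI impI, elim conjE)
    fix A assume A: "A \<subseteq> f ` P" "pairwise (\<lambda>p q. \<not> compatible (f ` P) le' p q) A"
    then obtain B where B: "B \<subseteq> P" "A = f ` B" by (meson subset_imageE)
    then have "pairwise (\<lambda>p q. \<not> compatible P le p q) B"
      using A(2) f compat unfolding pairwise_def inj_on_def by (metis imageI subsetD)
    then show "countable A" using ccc B by (auto simp: ccc_def)
  qed
  moreover have "|(`) f ` \<D>| \<le>o \<omega>\<^sub>1"
    using D(1) card_of_image ordLeq_transitive by blast
  moreover have "dense_subset (f ` P) le' D'" if D': "D' \<in> (`) f ` \<D>" for D'
  proof -
    obtain D0 where D0: "D' = f ` D0" "dense_subset P le D0"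
      using D' D(2) by blast
    then show ?thesis
      using le' unfolding dense_subset_def by (auto simp: subset_eq)
  qed
  ultimately obtain F where F: "poset_filter (f ` P) le' F"
    and meet: "\<forall>D\<in>(`) f ` \<D>. F \<inter> D \<noteq> {}"
    using assms(2) unfolding MA_omega1_def by meson
  show thesis
  proof
    show "poset_filter P le {p\<in>P. f p \<in> F}"
      unfolding poset_filter_def
    proof (intro conjI ballI impI)
      show "{p\<in>P. f p \<in> F} \<noteq> {}" using F by (fastforce simp: poset_filter_def)
      show "q \<in> {p\<in>P. f p \<in> F}" if "p \<in> {p\<in>P. f p \<in> F}" "q \<in> P" "le p q" for p q
        using F that le' by (auto simp: poset_filter_def)
      show "\<exists>r\<in>{p\<in>P. f p \<in> F}. le r p \<and> le r q"
        if pq: "p \<in> {p\<in>P. f p \<in> F}" "q \<in> {p\<in>P. f p \<in> F}" for p q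
      proof -
        obtain r where "r \<in> F" "le' r (f p)" "le' r (f q)"
          using F pq unfolding poset_filter_def by blast
        moreover from this obtain r' where "r' \<in> P" "r = f r'"
          using F unfolding poset_filter_def by blast
        ultimately show ?thesis using pq le' by blast
      qed
    qed auto
    show "{p\<in>P. f p \<in> F} \<inter> D \<noteq> {}" if "D \<in> \<D>" for D
    proof -
      have "D \<subseteq> P" using D(2) that by (simp add: dense_subset_def)
      moreover obtain d where "d \<in> D" "f d \<in> F" using meet \<open>D \<in> \<D>\<close> by blast
      ultimately show ?thesis by blast
    qed
  qed
qed

text \<open>Otherwise the conditions compatible with only countably many members of \<open>S\<close>
  would be dense. A maximal antichain \<open>M\<close> of them is countable by ccc, so some
  \<open>s\<close> in \<open>S\<close> is incompatible with all of \<open>M\<close>, and an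
  extension of \<open>s\<close> in the dense set contradicts maximality.\<close>

lemma ccc_uncountably_many_compatible:
  assumes po: "poset P le" and ccc: "ccc P le" and S: "S \<subseteq> P" "uncountable S"
  obtains p where "p \<in> P" "\<And>q. q \<in> P \<Longrightarrow> le q p \<Longrightarrow> uncountable {s\<in>S. compatible P le s q}"
proof (rule ccontr)
  assume "\<not> thesis"
  with that have bad: "\<exists>q\<in>P. le q p \<and> countable {s\<in>S. compatible P le s q}" if "p \<in> P" for p
    using that by blast
  let ?N = "{q\<in>P. countable {s\<in>S. compatible P le s q}}"
  have sym: "symp (compatible P le)"
    by (auto simp: symp_def compatible_def)
  obtain M where M: "M \<subseteq> ?N" "pairwise (\<lambda>p q. \<not> compatible P le p q) M"
    and max: "\<And>q. q \<in> ?N \<Longrightarrow> q \<notin> M \<Longrightarrow> \<exists>m\<in>M. compatible P le q m"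
    by (rule ex_maximal_pairwise[OF sym, of ?N]) (rule that)
  have "M \<subseteq> P" using M(1) by blast
  then have "countable M" using ccc M(2) by (auto simp: ccc_def)
  then have "countable (\<Union>m\<in>M. {s\<in>S. compatible P le s m})"
    using M(1) by (intro countable_UN) auto
  then have "\<not> S \<subseteq> (\<Union>m\<in>M. {s\<in>S. compatible P le s m})"
    using S(2) countable_subset by blast
  then obtain s where s: "s \<in> S" "\<And>m. m \<in> M \<Longrightarrow> \<not> compatible P le s m"
    by blast
  obtain q where q: "q \<in> ?N" "le q s"
    using bad s(1) S(1) by blast
  have "le q q" using q(1) po by (auto simp: poset_def reflp_on_def)
  \<comment> \<open>Since \<open>q\<close> itself extends \<open>s\<close>, it cannot be in
    \<open>M\<close>. Maximality then gives an \<open>m\<close> in \<open>M\<close> with a common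
    extension with \<open>q\<close>, which lies below \<open>s\<close> as well.\<close>
  then have "compatible P le s q" using q by (auto simp: compatible_def)
  with s(2) have "q \<notin> M" by blast
  then obtain m where m: "m \<in> M" "compatible P le q m" using max q(1) by blast
  then obtain r where r: "r \<in> P" "le r q" "le r m" by (auto simp: compatible_def)
  have "le r s"
    using po r(1,2) q s(1) S(1) unfolding poset_def transp_on_def by blast
  then show False using s(2) m(1) r by (auto simp: compatible_def)
qed

subsection \<open>The poset of finite cliques\<close>

text \<open>The relation is a parameter so that the complement of an edge relation gives the finite
  anticliques: \<open>clique\<close> ignores the diagonal.\<close>

definition finite_cliques :: "('a \<Rightarrow> 'a \<Rightarrow> bool) \<Rightarrow> 'a set \<Rightarrow> 'a set set"
  where "finite_cliques Q V = {p. finite p \<and> p \<subseteq> V \<and> clique Q p}"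

lemma finite_cliques_ordLeq:
  assumes V: "|V| =o \<omega>\<^sub>1"
  shows "|finite_cliques Q V| \<le>o \<omega>\<^sub>1"
proof -
  have "finite_cliques Q V \<subseteq> {S. finite S \<and> S \<subseteq> V}" by (auto simp: finite_cliques_def)
  moreover have "infinite V"
    using V uncountable_iff_omega1[of V] ordIso_iff_ordLeq countable_finite by blast
  ultimately have "|finite_cliques Q V| \<le>o |V|"
    using infinite_Fpow_ordLeq card_of_mono1 ordLeq_transitive by blast
  then show ?thesis using V ordLeq_ordIso_trans by blast
qed

lemma poset_superset: "A \<noteq> {} \<Longrightarrow> poset A (\<lambda>p q. q \<subseteq> p)"
  unfolding poset_def reflp_on_def transp_on_def antisymp_on_def by blast

text \<open>As an initial ordinal, the well-order \<open>|V|\<close> has proper initial segments of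
  cardinality below \<open>\<omega>\<^sub>1\<close>.\<close>

lemma countable_under_omega1:
  assumes "|V| =o \<omega>\<^sub>1" "v \<in> V"
  shows "countable (under |V| v)"
proof -
  have "|underS |V| v| <o |V|"
    using assms(2) by (intro card_of_underS[OF card_of_Card_order]) (simp add: Field_card_of)
  then have "|underS |V| v| <o \<omega>\<^sub>1" using assms(1) ordLess_ordIso_trans by blast
  then have "countable (underS |V| v)"
    using not_ordLess_ordLeq uncountable_iff_omega1 by blast
  moreover have "under |V| v \<subseteq> insert v (underS |V| v)"
    by (auto simp: under_def underS_def)
  ultimately show ?thesis using countable_insert countable_subset by metis
qed

text \<open>The union of a filter of cliques is a clique, but it could be countable. Working below a
  suitable condition \<open>p\<close> makes it dense to contain points arbitrarily high in the
  well-order \<open>|V|\<close>, so the union becomes unbounded.\<close>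

lemma uncountable_clique_if_ccc:
  assumes MA: "uncountable (UNIV :: 'p set)" "MA_omega1 TYPE('p)"
    and V: "|V| =o \<omega>\<^sub>1"
    and ccc: "ccc (finite_cliques Q V) (\<lambda>p q. q \<subseteq> p)" (is "ccc ?P ?le")
  shows "\<exists>C\<subseteq>V. uncountable C \<and> clique Q C"
proof -
  have uV: "uncountable V" using V uncountable_iff_omega1 ordIso_iff_ordLeq by blast
  have "{} \<in> ?P" by (simp add: finite_cliques_def clique_def)
  then have po: "poset ?P ?le" using poset_superset by blast
  have S: "(\<lambda>v. {v}) ` V \<subseteq> ?P" by (auto simp: finite_cliques_def clique_def)
  have uS: "uncountable ((\<lambda>v. {v}) ` V)"
    using uV countable_image_inj_on[of "\<lambda>v. {v}" V] by auto
  obtain p where p: "p \<in> ?P"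
    and unc: "\<And>q. q \<in> ?P \<Longrightarrow> p \<subseteq> q \<Longrightarrow> uncountable {s\<in>(\<lambda>v. {v}) ` V. compatible ?P ?le s q}"
    by (rule ccc_uncountably_many_compatible[OF po ccc S uS]) (rule that)
  define P' where "P' = {q\<in>?P. p \<subseteq> q}"
  have po': "poset P' ?le" using p by (intro poset_superset) (auto simp: P'_def)
  have ccc': "ccc P' ?le"
    unfolding ccc_def
  proof (intro allI impI, elim conjE)
    fix A assume A: "A \<subseteq> P'" "pairwise (\<lambda>p q. \<not> compatible P' ?le p q) A"
    \<comment> \<open>A common extension contains \<open>x\<close>, hence \<open>p\<close>, so it
      stays in \<open>P'\<close>; antichains of \<open>P'\<close> are therefore antichains of the
      whole poset.\<close>
    have "compatible P' ?le x y" if "compatible ?P ?le x y" "x \<in> P'" for x y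
      using that by (auto simp: compatible_def P'_def)
    then have "pairwise (\<lambda>p q. \<not> compatible ?P ?le p q) A"
      using A unfolding pairwise_def by blast
    moreover have "A \<subseteq> ?P" using A(1) by (auto simp: P'_def)
    ultimately show "countable A" using ccc by (auto simp: ccc_def)
  qed
  have "P' \<subseteq> ?P" by (auto simp: P'_def)
  then have card': "|P'| \<le>o \<omega>\<^sub>1"
    using finite_cliques_ordLeq[OF V] card_of_mono1 ordLeq_transitive by blast
  \<comment> \<open>For points of \<open>V\<close>, \<open>(w, v) \<notin> |V|\<close> says that
    \<open>w\<close> lies strictly above \<open>v\<close>.\<close>
  define D where "D v = {q\<in>P'. \<exists>w\<in>q. (w, v) \<notin> |V|}" for v
  have dense: "dense_subset P' ?le (D v)" if "v \<in> V" for v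
    unfolding dense_subset_def
  proof (intro conjI ballI)
    show "D v \<subseteq> P'" by (auto simp: D_def)
    fix q assume q: "q \<in> P'"
    let ?S = "{s\<in>(\<lambda>v. {v}) ` V. compatible ?P ?le s q}"
    have "uncountable ?S" using unc q by (auto simp: P'_def)
    moreover have "countable ((\<lambda>v. {v}) ` under |V| v)"
      using countable_under_omega1[OF V that] by simp
    \<comment> \<open>Uncountably many singletons are compatible with \<open>q\<close>, but only
      countably many points lie at or below \<open>v\<close>. So some clique \<open>r\<close>
      extends \<open>q\<close> and contains a point above \<open>v\<close>.\<close>
    ultimately have "\<not> ?S \<subseteq> (\<lambda>v. {v}) ` under |V| v"
      using countable_subset by blast
    then obtain w r where "(w, v) \<notin> |V|" "r \<in> ?P" "w \<in> r" "q \<subseteq> r"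
      by (auto simp: compatible_def under_def)
    then show "\<exists>d\<in>D v. q \<subseteq> d" using q by (intro bexI[of _ r]) (auto simp: D_def P'_def)
  qed
  have "|D ` V| \<le>o \<omega>\<^sub>1"
    using V card_of_image ordLeq_ordIso_trans by blast
  moreover have "dense_subset P' ?le X" if "X \<in> D ` V" for X
    using that dense by blast
  ultimately obtain F where F: "poset_filter P' ?le F"
    and "\<And>X. X \<in> D ` V \<Longrightarrow> F \<inter> X \<noteq> {}"
    by (rule MA_omega1_filter[OF MA card' po' ccc']) (assumption, rule that)
  then have meet: "F \<inter> D v \<noteq> {}" if "v \<in> V" for v
    using that by blast
  have FP: "F \<subseteq> ?P" using F by (auto simp: poset_filter_def P'_def)
  then have sub: "\<Union>F \<subseteq> V" by (auto simp: finite_cliques_def)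
  moreover have "clique Q (\<Union>F)"
    unfolding clique_def
  proof (intro ballI impI)
    fix x y assume xy: "x \<in> \<Union>F" "y \<in> \<Union>F" "x \<noteq> y"
    then obtain r where "r \<in> F" "x \<in> r" "y \<in> r"
      using F unfolding poset_filter_def by (metis UnionE subsetD)
    then show "Q x y" using FP xy(3) by (auto simp: finite_cliques_def clique_def)
  qed
  moreover have "uncountable (\<Union>F)"
  proof
    assume "countable (\<Union>F)"
    \<comment> \<open>A countable union of countable initial segments would cover \<open>V\<close>,
      because every \<open>v\<close> lies below some point of the union of \<open>F\<close>.\<close>
    then have "countable (\<Union>w\<in>\<Union>F. under |V| w)"
      using sub countable_under_omega1[OF V] by (intro countable_UN) auto
    moreover have "V \<subseteq> (\<Union>w\<in>\<Union>F. under |V| w)"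
    proof
      fix v assume v: "v \<in> V"
      then obtain q where "q \<in> F" "q \<in> D v" using meet by blast
      then obtain w where w: "w \<in> \<Union>F" "(w, v) \<notin> |V|" unfolding D_def by blast
      have "(v, w) \<in> |V|"
        using v w sub wo_rel.TOTALS[of "|V|"] card_of_Well_order[of V]
        by (auto simp: wo_rel_def Field_card_of)
      then show "v \<in> (\<Union>w\<in>\<Union>F. under |V| w)" using w by (auto simp: under_def)
    qed
    ultimately show False using uV countable_subset by blast
  qed
  ultimately show ?thesis by blast
qed

text \<open>Thin an uncountable antichain to a \<Delta>-system of sets of one size and delete the
  root. The union of two distinct members is not a clique though each member is, so the failing pair
  avoids the root and has one point in each remainder.\<close>

lemma disjoint_cliques_if_not_ccc:
  assumes sym: "symp_on V Q"
    and "\<not> ccc (finite_cliques Q V) (\<lambda>p q. q \<subseteq> p)" (is "\<not> ccc ?P ?le")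
  obtains T m where "uncountable T" "T \<subseteq> finite_cliques Q V" "\<And>s. s \<in> T \<Longrightarrow> card s = m"
    "\<And>s t. s \<in> T \<Longrightarrow> t \<in> T \<Longrightarrow> s \<noteq> t \<Longrightarrow> s \<inter> t = {} \<and> (\<exists>x\<in>s. \<exists>y\<in>t. \<not> Q x y)"
proof -
  obtain A where A: "A \<subseteq> ?P" "pairwise (\<lambda>p q. \<not> compatible ?P ?le p q) A" "uncountable A"
    using assms(2) by (auto simp: ccc_def)
  have "A = (\<Union>n. {a\<in>A. card a = n})" by blast
  then have "\<exists>n. uncountable {a\<in>A. card a = n}"
    using A(3) countable_UN[of UNIV "\<lambda>n. {a\<in>A. card a = n}"] by auto
  then obtain n where "uncountable {a\<in>A. card a = n}" ..
  moreover have "finite a \<and> card a = n" if "a \<in> {a\<in>A. card a = n}" for a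
    using that A(1) by (auto simp: finite_cliques_def)
  ultimately obtain R B where B: "B \<subseteq> {a\<in>A. card a = n}" "uncountable B"
    and R: "\<forall>a\<in>B. \<forall>b\<in>B. a \<noteq> b \<longrightarrow> a \<inter> b = R"
    using delta_system[of "{a\<in>A. card a = n}" n] by meson
  have BP: "finite a" "a \<subseteq> V" "clique Q a" "card a = n" if "a \<in> B" for a
    using that B(1) A(1) by (auto simp: finite_cliques_def)
  have RB: "R \<subseteq> a" if a: "a \<in> B" for a
  proof -
    have "B \<noteq> {a}" using B(2) by auto
    then obtain b where "b \<in> B" "b \<noteq> a" using a by blast
    then have "a \<inter> b = R" using R a by blast
    then show ?thesis by blast
  qed
  have inj: "inj_on (\<lambda>a. a - R) B"
    using RB by (intro inj_onI) (metis Diff_partition)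
  show thesis
  proof
    show "uncountable ((\<lambda>a. a - R) ` B)"
      using inj B(2) countable_image_inj_on by blast
    show "(\<lambda>a. a - R) ` B \<subseteq> ?P"
      using BP unfolding finite_cliques_def clique_def by blast
    show "card s = n - card R" if "s \<in> (\<lambda>a. a - R) ` B" for s
    proof -
      obtain a where a: "a \<in> B" "s = a - R" using \<open>s \<in> _\<close> by blast
      then have "finite R" using BP(1) RB finite_subset by blast
      then show ?thesis using a BP(4) RB by (simp add: card_Diff_subset)
    qed
    fix s t assume st: "s \<in> (\<lambda>a. a - R) ` B" "t \<in> (\<lambda>a. a - R) ` B" "s \<noteq> t"
    then obtain a b where ab: "a \<in> B" "b \<in> B" "a \<noteq> b" "s = a - R" "t = b - R" by blast
    have int: "a \<inter> b = R" using R ab by blast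
    have "\<not> compatible ?P ?le a b"
      using A(2) B(1) ab(1-3) unfolding pairwise_def by blast
    moreover have "finite (a \<union> b)" "a \<union> b \<subseteq> V" using BP ab by auto
    ultimately have "\<not> clique Q (a \<union> b)"
      by (auto simp: compatible_def finite_cliques_def)
    then obtain x y where xy: "x \<in> a \<union> b" "y \<in> a \<union> b" "x \<noteq> y" "\<not> Q x y"
      unfolding clique_def by blast
    \<comment> \<open>Symmetry allows the failing pair to be read in either order, whichever of its
      points lies in \<open>a\<close>.\<close>
    then have "\<not> Q y x" using sym BP ab unfolding symp_on_def by blast
    moreover have "\<not> (x \<in> a \<and> y \<in> a)" "\<not> (x \<in> b \<and> y \<in> b)"
      using xy BP(3) ab(1,2) unfolding clique_def by blast+
    ultimately have "\<exists>x\<in>s. \<exists>y\<in>t. \<not> Q x y"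
      unfolding ab(4,5) int[symmetric] using xy by blast
    then show "s \<inter> t = {} \<and> (\<exists>x\<in>s. \<exists>y\<in>t. \<not> Q x y)"
      unfolding ab(4,5) int[symmetric] by blast
  qed
qed

subsection \<open>Rectangular graphs\<close>

lemma clique_list_nth:
  assumes "distinct xs" "clique Q (set xs)" "i < length xs" "j < length xs" "i \<noteq> j"
  shows "xs ! i \<noteq> xs ! j" "Q (xs ! i) (xs ! j)"
  using assms by (auto simp: clique_def nth_eq_iff_index_eq)

lemma rectangular_ccc:
  assumes sg: "simple_graph V E" and rect: "rectangular V E" and V: "|V| =o \<omega>\<^sub>1"
  shows "ccc (finite_cliques E V) (\<lambda>p q. q \<subseteq> p) \<or>
    ccc (finite_cliques (\<lambda>x y. \<not> E x y) V) (\<lambda>p q. q \<subseteq> p)"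
proof (rule ccontr)
  assume neg: "\<not> ?thesis"
  let ?N = "\<lambda>x y. \<not> E x y"
  have sym: "symp_on V E" "symp_on V ?N"
    using sg by (auto simp: simple_graph_def symp_on_def)
  obtain S m where
    S: "uncountable S" "S \<subseteq> finite_cliques ?N V" "\<And>s. s \<in> S \<Longrightarrow> card s = m"
      "\<And>s t. s \<in> S \<Longrightarrow> t \<in> S \<Longrightarrow> s \<noteq> t \<Longrightarrow> s \<inter> t = {} \<and> (\<exists>x\<in>s. \<exists>y\<in>t. \<not> \<not> E x y)"
    using neg by (elim disjoint_cliques_if_not_ccc[OF sym(2), rotated]) blast
  obtain T n where
    T: "uncountable T" "T \<subseteq> finite_cliques E V" "\<And>s. s \<in> T \<Longrightarrow> card s = n"
      "\<And>s t. s \<in> T \<Longrightarrow> t \<in> T \<Longrightarrow> s \<noteq> t \<Longrightarrow> s \<inter> t = {} \<and> (\<exists>x\<in>s. \<exists>y\<in>t. \<not> E x y)"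
    using neg by (elim disjoint_cliques_if_not_ccc[OF sym(1), rotated]) blast
  have S_le: "|S| \<le>o \<omega>\<^sub>1"
    using finite_cliques_ordLeq[OF V] card_of_mono1[OF S(2)] ordLeq_transitive by blast
  moreover have "\<omega>\<^sub>1 \<le>o |T|" using T(1) uncountable_iff_omega1 by blast
  ultimately have "|S| \<le>o |T|" using ordLeq_transitive by blast
  \<comment> \<open>This injection assigns to each anticlique in \<open>S\<close> its own clique in
    \<open>T\<close>.\<close>
  then obtain h where h: "inj_on h S" "h ` S \<subseteq> T" by (meson card_of_ordLeq)
  obtain l :: "'a set \<Rightarrow> 'a list" where l: "\<And>s. finite s \<Longrightarrow> set (l s) = s \<and> distinct (l s)"
    using finite_distinct_list by metis
  have lS: "set (l s) = s" "distinct (l s)" "length (l s) = m" "s \<subseteq> V" "clique ?N s"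
    if "s \<in> S" for s
  proof -
    have "finite s" "s \<subseteq> V" "clique ?N s" "card s = m"
      using S(2) S(3)[OF that] that by (auto simp: finite_cliques_def)
    then show "set (l s) = s" "distinct (l s)" "length (l s) = m" "s \<subseteq> V" "clique ?N s"
      using l[of s] distinct_card[of "l s"] by simp_all
  qed
  have lT: "set (l s) = s" "distinct (l s)" "length (l s) = n" "s \<subseteq> V" "clique E s"
    if "s \<in> T" for s
  proof -
    have "finite s" "s \<subseteq> V" "clique E s" "card s = n"
      using T(2) T(3)[OF that] that by (auto simp: finite_cliques_def)
    then show "set (l s) = s" "distinct (l s)" "length (l s) = n" "s \<subseteq> V" "clique E s"
      using l[of s] distinct_card[of "l s"] by simp_all
  qed
  have "countable (s \<union> h s)" if "s \<in> S" for s
  proof -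
    have "h s \<in> T" using that h(2) by blast
    then have "finite (s \<union> h s)" using that S(2) T(2) by (auto simp: finite_cliques_def)
    then show ?thesis by (rule countable_finite)
  qed
  \<comment> \<open>Sets \<open>s\<close> and \<open>h t\<close> may intersect, so another thinning
    is needed. A point lies in at most one \<open>s\<close> and, by injectivity of \<open>h\<close>,
    in at most one \<open>h s\<close>.\<close>
  moreover have "countable {s\<in>S. x \<in> s \<union> h s}" for x
  proof -
    have singleton: "countable A" if "\<And>s t. s \<in> A \<Longrightarrow> t \<in> A \<Longrightarrow> s = t" for A :: "'a set set"
    proof (cases "A = {}")
      case False
      then obtain s where "s \<in> A" by blast
      then have "A = {s}" using that by blast
      then show ?thesis by simp
    qed simp
    have "countable {s\<in>S. x \<in> s}"
      using S(4) by (intro singleton) blast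
    moreover have "countable {s\<in>S. x \<in> h s}"
    proof (rule singleton)
      fix s t assume "s \<in> {s\<in>S. x \<in> h s}" "t \<in> {s\<in>S. x \<in> h s}"
      then have st: "s \<in> S" "t \<in> S" "h s \<inter> h t \<noteq> {}" by auto
      then have "h s = h t" using T(4)[of "h s" "h t"] h(2) by blast
      then show "s = t" using st(1,2) h(1) by (simp add: inj_on_eq_iff)
    qed
    moreover have "{s\<in>S. x \<in> s \<union> h s} = {s\<in>S. x \<in> s} \<union> {s\<in>S. x \<in> h s}" by blast
    ultimately show ?thesis by simp
  qed
  ultimately obtain J where J: "J \<subseteq> S" "uncountable J" "disjoint_family_on (\<lambda>s. s \<union> h s) J"
    using uncountable_disjoint_subfamily[OF S(1), of "\<lambda>s. s \<union> h s"] by blast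
  \<comment> \<open>Positions below \<open>m\<close> hold the anticlique and the next
    \<open>n\<close> hold the clique. A point shared by \<open>s\<close> and \<open>h s\<close>
    would be repeated; this is harmless, as entries are compared by \<open>cross\<close> only within
    one block.\<close>
  define L where "L s = l s @ l (h s)" for s
  have setL: "set (L s) = s \<union> h s" if "s \<in> J" for s
  proof -
    have "s \<in> S" "h s \<in> T" using that J(1) h(2) by blast+
    then show ?thesis by (simp add: L_def lS(1) lT(1))
  qed
  have injL: "inj_on L J"
  proof (rule inj_onI)
    fix s t assume "s \<in> J" "t \<in> J" "L s = L t"
    moreover from this have "s \<in> S" "t \<in> S" using J(1) by blast+
    ultimately show "s = t" using lS(1,3) by (metis L_def append_eq_append_conv)
  qed
  have "|L ` J| =o \<omega>\<^sub>1"
  proof -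
    have "|L ` J| \<le>o |S|"
      using card_of_image J(1) card_of_mono1 ordLeq_transitive by blast
    moreover have "uncountable (L ` J)" using injL J(2) countable_image_inj_on by blast
    ultimately show ?thesis
      using S_le ordLeq_transitive uncountable_iff_omega1 ordIso_iff_ordLeq by blast
  qed
  moreover have "\<forall>x\<in>L ` J. length x = m + n \<and> set x \<subseteq> V"
  proof
    fix x assume "x \<in> L ` J"
    then obtain s where "s \<in> S" "h s \<in> T" "x = L s" using J(1) h(2) by blast
    then show "length x = m + n \<and> set x \<subseteq> V"
      using lS(1,3,4)[of s] lT(1,3,4)[of "h s"] by (simp add: L_def)
  qed
  moreover have "disjoint_family_on set (L ` J)"
    unfolding disjoint_family_on_def
  proof (intro ballI impI)
    fix x y assume "x \<in> L ` J" "y \<in> L ` J" "x \<noteq> y"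
    then obtain s t where "s \<in> J" "t \<in> J" "s \<noteq> t" "x = L s" "y = L t" by blast
    then show "set x \<inter> set y = {}"
      using J(3) setL[of s] setL[of t] unfolding disjoint_family_on_def by simp
  qed
  ultimately obtain x y where "x \<in> L ` J" "y \<in> L ` J" "x \<noteq> y" and xy: "alike E x y"
    using rect unfolding rectangular_def by meson
  then obtain s t where st: "s \<in> S" "t \<in> S" "s \<noteq> t" and x: "x = L s" and y: "y = L t"
    using J(1) by blast
  have hst: "h s \<in> T" "h t \<in> T" "h s \<noteq> h t"
    using st h by (auto simp: inj_on_eq_iff)
  have len: "length x = m + n" using x st(1) hst(1) lS(3) lT(3) by (simp add: L_def)
  have nth1: "x ! i = l s ! i" "y ! i = l t ! i" if "i < m" for i
    using that st lS(3) by (simp_all add: x y L_def nth_append)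
  have nth2: "x ! (m + i) = l (h s) ! i" "y ! (m + i) = l (h t) ! i" if "i < n" for i
    using that st lS(3) by (simp_all add: x y L_def nth_append)
  have diag: "E (x ! i) (y ! i) \<longleftrightarrow> E (x ! j) (y ! j)" if "i < m + n" "j < m + n" for i j
    using xy that len unfolding alike_def by metis
  have cross: "E (x ! i) (y ! j) \<longleftrightarrow> E (x ! i) (x ! j)"
    if "i < m + n" "j < m + n" "x ! i \<noteq> x ! j" for i j
    using xy that len unfolding alike_def by metis
  obtain i j where ij: "i < m" "j < m" "E (l s ! i) (l t ! j)"
    using S(4)[OF st] lS(1,3) st by (metis in_set_conv_nth)
  \<comment> \<open>At distinct indices of the anticlique block, \<open>cross\<close> would turn the
    edge between \<open>x\<close> and \<open>y\<close> into an edge inside \<open>s\<close>.\<close>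
  have "i = j"
  proof (rule ccontr)
    assume "i \<noteq> j"
    then have "l s ! i \<noteq> l s ! j" "\<not> E (l s ! i) (l s ! j)"
      using clique_list_nth[of "l s" ?N i j] lS[OF st(1)] ij by simp_all
    then show False using cross[of i j] ij nth1 by simp
  qed
  obtain i' j' where ij': "i' < n" "j' < n" "\<not> E (l (h s) ! i') (l (h t) ! j')"
    using T(4)[OF hst] lT(1,3) hst by (metis in_set_conv_nth)
  \<comment> \<open>Dually, \<open>cross\<close> would turn the non-edge into a non-edge inside the
    clique \<open>h s\<close>.\<close>
  have "i' = j'"
  proof (rule ccontr)
    assume "i' \<noteq> j'"
    then have "l (h s) ! i' \<noteq> l (h s) ! j'" "E (l (h s) ! i') (l (h s) ! j')"
      using clique_list_nth[of "l (h s)" E i' j'] lT[OF hst(1)] ij' by simp_all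
    then show False using cross[of "m + i'" "m + j'"] ij' nth2 by simp
  qed
  \<comment> \<open>The diagonal pair at \<open>i\<close> is an edge and the one at
    \<open>m + i'\<close> is not, against \<open>diag\<close>.\<close>
  show False
    using diag[of i "m + i'"] ij ij' nth1 nth2 \<open>i = j\<close> \<open>i' = j'\<close> by simp
qed

theorem mainTheorem14:
  fixes V :: "'a set" and E :: "'a \<Rightarrow> 'a \<Rightarrow> bool"
  assumes "uncountable (UNIV :: 'p set)"
    and "MA_omega1 TYPE('p)"
    and "simple_graph V E"
    and "rectangular V E"
    and "|V| =o \<omega>\<^sub>1"
  shows "\<exists>C\<subseteq>V. uncountable C \<and> (clique E C \<or> anticlique E C)"
  using rectangular_ccc[OF assms(3-5)]
proof
  assume "ccc (finite_cliques E V) (\<lambda>p q. q \<subseteq> p)"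
  then show ?thesis using uncountable_clique_if_ccc[OF assms(1,2,5)] by blast
next
  assume "ccc (finite_cliques (\<lambda>x y. \<not> E x y) V) (\<lambda>p q. q \<subseteq> p)"
  then obtain C where C: "C \<subseteq> V" "uncountable C" "clique (\<lambda>x y. \<not> E x y) C"
    using uncountable_clique_if_ccc[OF assms(1,2,5)] by blast
  \<comment> \<open>\<open>clique\<close> says nothing about the diagonal, whereas
    \<open>anticlique\<close> includes it; irreflexivity fills the gap.\<close>
  moreover have "\<not> E x x" if "x \<in> C" for x
    using assms(3) C(1) that by (auto simp: simple_graph_def irreflp_on_def)
  ultimately have "anticlique E C" unfolding anticlique_def clique_def by metis
  then show ?thesis using C by blast
qed

end
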